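(* Let $\Omega=\mathbb T^d$ be the flat torus. Suppose that $f$ satisfies: - $f\in C^2(\mathbb T^d\times(0,\infty))\cap L^1_{\mathrm{loc}}(\mathbb T^d\times[0,\infty))$; - $uf,\ uf_x\in C(\mathbb T^d\times[0,\infty))$; - $f_u<0$; - $|f(x,u)|\le g_1(u)$ for a.a. $u>0$, with some $g_1\in L^1_{\mathrm{loc}}[0,\infty)$; - $f(x,m(x))=0$ for all $x\in\mathbb T^d$, where $m:\mathbb T^d\to(0,\infty)$ is a $C^2$-smooth probability density; - $\lim_{u\to\infty}f(x,u)=-\infty$ uniformly with respect to $x\in\mathbb T^d$. Let $u^0\in L^1(\mathbb T^d)$ be a probability density with $\mathcal E(u^0)<\infty$. Then $$d_{HKS}^2(u^0,m)\le C\,\mathcal E(u^0),$$ with $C$ independent of $u^0$.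
   Context: $f_x$ denotes the gradient of $f(x,u)$ in $x$. The relative entropy of a nonnegative $u\in L^1(\mathbb T^d)$ is $\mathcal E(u)=\int_{\mathbb T^d}E(x,u(x))\,dx\in[0,\infty]$ with $E(x,u)=-\int_{m(x)}^uf(x,\xi)\,d\xi$ for $u\ge0$. Probability densities are identified with the corresponding measures. $\mathcal P$ is the set of probability measures on $\mathbb T^d$. The spherical Hellinger–Kantorovich distance between $\rho_0,\rho_1\in\mathcal P$ is defined by $$d_{HKS}^2(\rho_0,\rho_1)=\inf_{\mathcal A_1(\rho_0,\rho_1)}\int_0^1\left(\int_{\mathbb T^d}(|v_t|^2+|\alpha_t|^2)\,d\rho_t\right)dt,$$ where $\mathcal A_1(\rho_0,\rho_1)$ consists of all $(\rho_t,\alpha_t,v_t)_{t\in[0,1]}$ such that $\rho\in C_w([0,1];\mathcal P)$ (weakly continuous curves), $\rho|_{t=0}=\rho_0$, $\rho|_{t=1}=\rho_1$, $(\alpha,v)\in L^2(0,1;L^2(d\rho_t)\times L^2(d\rho_t)^d)$ (scalar $\alpha_t$, vector $v_t$), and $\partial_t\rho_t+\operatorname{div}(\rho_tv_t)=\rho_t\alpha_t$ in the weak sense. *)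

theory Defs
  imports "HOL-Analysis.Analysis" "HOL-Probability.Probability"
begin

text \<open>The flat torus as the quotient of \<open>real ^ 'n\<close> by the integer lattice, with the
  quotient topology.\<close>

definition torus_rel :: "real ^ 'n \<Rightarrow> real ^ 'n \<Rightarrow> bool" where
  "torus_rel x y \<longleftrightarrow> (\<forall>i. x $ i - y $ i \<in> \<int>)"

lemma equivp_torus_rel: "equivp torus_rel"
proof (rule equivpI)
  show "reflp torus_rel" by (simp add: reflp_def torus_rel_def)
  show "symp torus_rel"
    unfolding symp_def torus_rel_def by (metis Ints_minus minus_diff_eq)
  show "transp torus_rel"
  proof (rule transpI)
    fix x y z :: "real ^ 'n" assume "torus_rel x y" "torus_rel y z"
    then have "(x $ i - y $ i) + (y $ i - z $ i) \<in> \<int>" for i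
      unfolding torus_rel_def by (intro Ints_add) auto
    then show "torus_rel x z" by (simp add: torus_rel_def)
  qed
qed

quotient_type 'n torus = "real ^ 'n" / torus_rel
  by (rule equivp_torus_rel)

lift_definition torus_proj :: "real ^ 'n \<Rightarrow> 'n torus" is "\<lambda>x. x" .

instantiation torus :: (finite) topological_space
begin

definition open_torus :: "'a torus set \<Rightarrow> bool" where
  "open_torus U \<longleftrightarrow> open (torus_proj -` U)"

instance
  by standard (auto simp: open_torus_def vimage_Int vimage_Union)

end

lemma continuous_on_torus_proj: "continuous_on A torus_proj"
  by (rule continuous_on_subset[of UNIV]) (auto simp: continuous_on_open_vimage open_torus_def)

definition torus_cell :: "(real ^ 'n) set" where
  "torus_cell = {x. \<forall>i. 0 \<le> x $ i \<and> x $ i < 1}"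

definition torus_lborel :: "'n::finite torus measure" where
  "torus_lborel = distr (restrict_space lborel torus_cell) borel torus_proj"

lemma space_torus_lborel [simp]: "space torus_lborel = UNIV"
  and sets_torus_lborel [simp, measurable_cong]: "sets torus_lborel = sets borel"
  by (simp_all add: torus_lborel_def)

lemma measurable_torus_proj [measurable]: "torus_proj \<in> borel_measurable borel"
  by (rule borel_measurable_continuous_onI) (rule continuous_on_torus_proj)

lemma prob_space_torus_lborel: "prob_space (torus_lborel :: 'n::finite torus measure)"
proof -
  have "(One :: real ^ 'n) \<bullet> axis i 1 = 1" for i
    
    using inner_sum_left_Basis[of "axis i 1 :: real ^ 'n" "\<lambda>_. 1"]
    by (simp only: scaleR_one axis_in_Basis_iff) simp
  then have One: "(One :: real ^ 'n) $ i = 1" for i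
    by (simp only: inner_axis) simp
  have box: "box 0 One \<subseteq> (torus_cell :: (real ^ 'n) set)" "torus_cell \<subseteq> (cbox 0 One :: (real ^ 'n) set)"
    by (auto simp del: sum_component simp: torus_cell_def mem_box_cart less_imp_le One)
  have cell: "(torus_cell :: (real ^ 'n) set) \<in> sets borel"
    unfolding torus_cell_def by measurable
  have "emeasure lborel (torus_cell :: (real ^ 'n) set) = 1"
  proof (rule antisym)
    have "emeasure lborel (torus_cell :: (real ^ 'n) set) \<le> emeasure lborel (cbox 0 One :: (real ^ 'n) set)"
      using box by (intro emeasure_mono) auto
    then show "emeasure lborel (torus_cell :: (real ^ 'n) set) \<le> 1"
      by (simp add: emeasure_lborel_cbox_eq)
    have "emeasure lborel (box 0 One :: (real ^ 'n) set) \<le> emeasure lborel (torus_cell :: (real ^ 'n) set)"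
      using box cell by (intro emeasure_mono) auto
    then show "1 \<le> emeasure lborel (torus_cell :: (real ^ 'n) set)"
      by (simp add: emeasure_lborel_box_eq)
  qed
  then show ?thesis
    unfolding torus_lborel_def using cell
    by (intro prob_space.prob_space_distr prob_spaceI)
       (auto simp: emeasure_restrict_space space_restrict_space intro!: measurable_restrict_space1)
qed

text \<open>Continuous differentiability on an open set \<open>S\<close>, with Frechet derivatives.\<close>

definition C1_on :: "'a::real_normed_vector set \<Rightarrow> ('a \<Rightarrow> 'b::real_normed_vector) \<Rightarrow> bool" where
  "C1_on S g \<longleftrightarrow> (\<exists>g' :: 'a \<Rightarrow> 'a \<Rightarrow>\<^sub>L 'b.
     (\<forall>x\<in>S. (g has_derivative blinfun_apply (g' x)) (at x)) \<and> continuous_on S g')"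

definition C2_on :: "'a::real_normed_vector set \<Rightarrow> ('a \<Rightarrow> 'b::real_normed_vector) \<Rightarrow> bool" where
  "C2_on S g \<longleftrightarrow> (\<exists>g' :: 'a \<Rightarrow> 'a \<Rightarrow>\<^sub>L 'b.
     (\<forall>x\<in>S. (g has_derivative blinfun_apply (g' x)) (at x)) \<and> C1_on S g')"

text \<open>Functions on the torus are differentiated through their periodic lifts; the gradient of a
  lift is itself periodic, so the value below does not depend on the representative \<open>y\<close>.\<close>

definition torus_grad :: "('n::finite torus \<Rightarrow> real) \<Rightarrow> 'n::finite torus \<Rightarrow> real ^ 'n" where
  "torus_grad g x = (THE D. \<forall>y. torus_proj y = x \<longrightarrow> GDERIV (\<lambda>z. g (torus_proj z)) y :> D)"

text \<open>For functions given on \<open>u > 0\<close> only, membership in the continuous functions on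
  \<open>u \<ge> 0\<close> means existence of a continuous extension; the value of \<open>h\<close> at \<open>u = 0\<close> is ignored.\<close>

definition continuous_upto_0 ::
    "('x::topological_space \<Rightarrow> real \<Rightarrow> 'b::topological_space) \<Rightarrow> bool" where
  "continuous_upto_0 h \<longleftrightarrow> (\<exists>H. continuous_on (UNIV \<times> {0..}) H \<and>
     (\<forall>x. \<forall>u>0. H (x, u) = h x u))"

definition prob_density :: "('n::finite torus \<Rightarrow> real) \<Rightarrow> bool" where
  "prob_density u \<longleftrightarrow> integrable torus_lborel u \<and> (AE x in torus_lborel. 0 \<le> u x) \<and>
     (\<integral>x. u x \<partial>torus_lborel) = 1"

definition density_measure :: "('n::finite torus \<Rightarrow> real) \<Rightarrow> 'n::finite torus measure" where
  "density_measure u = density torus_lborel (\<lambda>x. ennreal (u x))"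

text \<open>The interval integral is oriented: \<open>u < m x\<close> reverses its sign.\<close>

definition entropy_density ::
    "('n::finite torus \<Rightarrow> real \<Rightarrow> real) \<Rightarrow> ('n::finite torus \<Rightarrow> real) \<Rightarrow> 'n::finite torus \<Rightarrow> real \<Rightarrow> real" where
  "entropy_density f m x u = - (LBINT \<xi>=ereal (m x)..ereal u. f x \<xi>)"

text \<open>If \<open>f x\<close> is decreasing and vanishes at \<open>m x\<close>, then the entropy density is nonnegative, so
  that \<open>ennreal\<close> truncates nothing.\<close>

definition relative_entropy ::
    "('n::finite torus \<Rightarrow> real \<Rightarrow> real) \<Rightarrow> ('n::finite torus \<Rightarrow> real) \<Rightarrow> ('n::finite torus \<Rightarrow> real) \<Rightarrow> ennreal" where
  "relative_entropy f m u =
     (\<integral>\<^sup>+x. ennreal (entropy_density f m x (u x)) \<partial>torus_lborel)"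

definition torus_prob_measures :: "'n::finite torus measure set" where
  "torus_prob_measures = {\<mu>. prob_space \<mu> \<and> sets \<mu> = sets borel}"

definition weakly_continuous_curve :: "(real \<Rightarrow> 'n::finite torus measure) \<Rightarrow> bool" where
  "weakly_continuous_curve \<rho> \<longleftrightarrow> (\<forall>t\<in>{0..1}. \<rho> t \<in> torus_prob_measures) \<and>
     (\<forall>\<phi> :: 'n::finite torus \<Rightarrow> real. continuous_on UNIV \<phi> \<longrightarrow>
        continuous_on {0..1} (\<lambda>t. \<integral>x. \<phi> x \<partial>\<rho> t))"

definition hks_action ::
    "(real \<Rightarrow> 'n::finite torus measure) \<Rightarrow> (real \<Rightarrow> 'n::finite torus \<Rightarrow> real) \<Rightarrow>
     (real \<Rightarrow> 'n::finite torus \<Rightarrow> real ^ 'n) \<Rightarrow> ennreal" where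
  "hks_action \<rho> \<alpha> v =
     (\<integral>\<^sup>+t\<in>{0..1}. (\<integral>\<^sup>+x. ennreal ((norm (v t x))\<^sup>2 + \<bar>\<alpha> t x\<bar>\<^sup>2) \<partial>\<rho> t) \<partial>lborel)"

text \<open>Square integrability with respect to the measure \<open>d\<rho>\<^sub>t dt\<close> on \<open>[0,1] \<times> torus\<close>, for jointly
  Borel representatives.\<close>

definition hks_square_integrable ::
    "(real \<Rightarrow> 'n::finite torus measure) \<Rightarrow> (real \<Rightarrow> 'n::finite torus \<Rightarrow> real) \<Rightarrow>
     (real \<Rightarrow> 'n::finite torus \<Rightarrow> real ^ 'n) \<Rightarrow> bool" where
  "hks_square_integrable \<rho> \<alpha> v \<longleftrightarrow>
     (\<lambda>(t, x). \<alpha> t x) \<in> borel_measurable (restrict_space borel {0..1} \<Otimes>\<^sub>M borel) \<and>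
     (\<lambda>(t, x). v t x) \<in> borel_measurable (restrict_space borel {0..1} \<Otimes>\<^sub>M borel) \<and>
     hks_action \<rho> \<alpha> v < \<infinity>"

text \<open>Test functions: continuously differentiable with compact support in \<open>(0,1) \<times> torus\<close>.\<close>

definition test_function :: "(real \<Rightarrow> 'n::finite torus \<Rightarrow> real) \<Rightarrow> bool" where
  "test_function \<phi> \<longleftrightarrow> C1_on UNIV (\<lambda>(t, y). \<phi> t (torus_proj y)) \<and>
     (\<exists>a b. 0 < a \<and> a < b \<and> b < 1 \<and> (\<forall>t. t \<notin> {a..b} \<longrightarrow> (\<forall>x. \<phi> t x = 0)))"

text \<open>The weak form of \<open>\<partial>\<^sub>t \<rho> + div (\<rho> v) = \<rho> \<alpha>\<close>. For square integrable \<open>\<alpha>\<close> and \<open>v\<close> the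
  integrals below converge absolutely (the inner one for almost every \<open>t\<close>).\<close>

definition weak_continuity_reaction_eq ::
    "(real \<Rightarrow> 'n::finite torus measure) \<Rightarrow> (real \<Rightarrow> 'n::finite torus \<Rightarrow> real) \<Rightarrow>
     (real \<Rightarrow> 'n::finite torus \<Rightarrow> real ^ 'n) \<Rightarrow> bool" where
  "weak_continuity_reaction_eq \<rho> \<alpha> v \<longleftrightarrow> (\<forall>\<phi>. test_function \<phi> \<longrightarrow>
     (LBINT t:{0..1}. (\<integral>x. (deriv (\<lambda>s. \<phi> s x) t + v t x \<bullet> torus_grad (\<phi> t) x
        + \<alpha> t x * \<phi> t x) \<partial>\<rho> t)) = 0)"

definition hks_admissible ::
    "'n::finite torus measure \<Rightarrow> 'n::finite torus measure \<Rightarrow>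
     ((real \<Rightarrow> 'n::finite torus measure) \<times> (real \<Rightarrow> 'n::finite torus \<Rightarrow> real) \<times>
      (real \<Rightarrow> 'n::finite torus \<Rightarrow> real ^ 'n)) set" where
  "hks_admissible \<rho>0 \<rho>1 = {(\<rho>, \<alpha>, v). weakly_continuous_curve \<rho> \<and> \<rho> 0 = \<rho>0 \<and> \<rho> 1 = \<rho>1 \<and>
     hks_square_integrable \<rho> \<alpha> v \<and> weak_continuity_reaction_eq \<rho> \<alpha> v}"

text \<open>The squared spherical Hellinger-Kantorovich distance, with infimum \<open>\<infinity>\<close> over the empty set.\<close>

definition hks_dist_sq :: "'n::finite torus measure \<Rightarrow> 'n::finite torus measure \<Rightarrow> ennreal" where
  "hks_dist_sq \<rho>0 \<rho>1 = (INF (\<rho>, \<alpha>, v) \<in> hks_admissible \<rho>0 \<rho>1. hks_action \<rho> \<alpha> v)"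

end

theory Submission
  imports Defs
begin

text \<open>
  A curve with \<open>v = 0\<close>, which only creates and destroys mass, is already short enough. For densities \<open>u\<close> and \<open>m\<close>, every interpolation
  \<open>u\<^sub>t = (1 - s t) u + s t m\<close> keeps total mass one, so the spherical constraint costs nothing, and it
  solves \<open>\<partial>\<^sub>t u\<^sub>t = \<alpha>\<^sub>t u\<^sub>t\<close> with \<open>\<alpha>\<^sub>t = s' t (m - u) / u\<^sub>t\<close>. Its action density is
  \<open>(s' t)\<^sup>2 (m - u)\<^sup>2 / u\<^sub>t\<close>. For constant speed, \<open>s t = t\<close>, its time integral is
  \<open>(m - u) (ln m - ln u)\<close>, which is infinite where \<open>u = 0\<close>. The choice
  \<open>s t = t\<^sup>2 (3 - 2 t)\<close> slows the curve down at both ends: \<open>s' t = 6 t (1 - t)\<close>, while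
  \<open>s t \<ge> t\<^sup>2\<close> and \<open>1 - s t \<ge> (1 - t)\<^sup>2\<close>, so that the action density is at most
  \<open>36 (u - m)\<^sup>2 / (u + m)\<close> (\<open>interpolate_action_bound\<close>, \<open>hks_dist_sq_le\<close>). Up to constants this is
  the squared Hellinger distance.

  It remains to bound \<open>(u - m)\<^sup>2 / (u + m)\<close> pointwise by the entropy density
  (\<open>entropy_density_lower_bound\<close>). By compactness \<open>f\<close> decreases in \<open>u\<close> at a rate
  bounded away from zero on a neighbourhood of the range of \<open>m\<close>, and monotonicity carries the
  resulting lower bound on \<open>\<bar>f\<bar>\<close> to all other \<open>u\<close>. This gives
  \<open>\<bar>f(x,\<xi>)\<bar> \<ge> k \<bar>\<xi> - m\<bar> / (\<xi> + m)\<close>, whose right hand side is comparable with the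
  \<open>\<xi>\<close>-derivative of \<open>(\<xi> - m)\<^sup>2 / (\<xi> + m)\<close>; integrating from \<open>m\<close> to \<open>u\<close> yields the claim.
\<close>

section \<open>The torus as a compact quotient\<close>

lemma torus_representative:
  fixes x :: "'n::finite torus"
  obtains y where "y \<in> cbox 0 1" "torus_proj y = x"
proof -
  obtain z where z: "x = torus_proj z"
    by (metis (no_types) Quotient_abs_rep Quotient_torus torus_proj.abs_eq)
  have "torus_rel (\<chi> i. frac (z $ i)) z"
    by (simp add: torus_rel_def frac_def)
  then have "torus_proj (\<chi> i. frac (z $ i)) = x"
    unfolding z by transfer
  moreover have "(\<chi> i. frac (z $ i)) \<in> cbox 0 (1 :: real ^ 'n)"
    by (auto simp: mem_box_cart frac_lt_1 less_imp_le)
  ultimately show ?thesis using that by blast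
qed

lemma compact_torus: "compact (UNIV :: 'n::finite torus set)"
proof -
  have "(UNIV :: 'n torus set) = torus_proj ` cbox 0 1"
    using torus_representative by (metis UNIV_eq_I image_eqI)
  also have "compact \<dots>"
    by (intro compact_continuous_image continuous_on_torus_proj compact_cbox)
  finally show ?thesis .
qed

lemma continuous_on_torus:
  fixes g :: "'n::finite torus \<Rightarrow> 'b::topological_space"
  assumes "continuous_on UNIV (\<lambda>y. g (torus_proj y))"
  shows "continuous_on UNIV g"
proof -
  have "open (g -` B)" if "open B" for B
    using continuous_on_open_vimage[OF open_UNIV, THEN iffD1, OF assms] that
    by (auto simp: open_torus_def vimage_def)
  then show ?thesis
    by (simp add: continuous_on_open_vimage)
qed

text \<open>Periodicity makes the unit cube, which is compact, see all values.\<close>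

lemma torus_pair_bound:
  fixes \<Phi> :: "real \<Rightarrow> 'n::finite torus \<Rightarrow> real"
  assumes "continuous_on UNIV (\<lambda>(t, y). \<Phi> t (torus_proj y))"
  obtains K where "0 \<le> K" "\<And>t x. t \<in> {a..b} \<Longrightarrow> \<bar>\<Phi> t x\<bar> \<le> K"
proof -
  let ?g = "\<lambda>(t, y). \<Phi> t (torus_proj y)"
  have "compact (?g ` ({a..b} \<times> cbox 0 1))"
    by (intro compact_continuous_image continuous_on_subset[OF assms] compact_Times) auto
  then obtain K where K: "\<forall>z \<in> ?g ` ({a..b} \<times> cbox 0 1). norm z \<le> K"
    by (meson bounded_iff compact_imp_bounded)
  have "\<bar>\<Phi> t x\<bar> \<le> max K 0" if "t \<in> {a..b}" for t x
  proof -
    obtain y where "y \<in> cbox 0 1" "torus_proj y = x"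
      using torus_representative .
    with K that show ?thesis by force
  qed
  then show ?thesis using that[of "max K 0"] by simp
qed

section \<open>Differentiation under the integral sign\<close>

text \<open>By the mean value inequality on the convex set \<open>S\<close>, the majorant \<open>w\<close> of the derivative also
  dominates the difference quotients, so dominated convergence applies to them.\<close>

lemma DERIV_under_integral:
  fixes h h' :: "real \<Rightarrow> 'a \<Rightarrow> real"
  assumes S: "convex S" "t \<in> S"
    and int: "\<And>s. s \<in> S \<Longrightarrow> integrable M (h s)"
    and der: "\<And>s x. s \<in> S \<Longrightarrow> ((\<lambda>s. h s x) has_real_derivative h' s x) (at s within S)"
    and bound: "\<And>s x. s \<in> S \<Longrightarrow> \<bar>h' s x\<bar> \<le> w x"
    and w: "integrable M w"
    and meas: "h' t \<in> borel_measurable M"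
  shows "((\<lambda>s. \<integral>x. h s x \<partial>M) has_real_derivative (\<integral>x. h' t x \<partial>M)) (at t within S)"
  unfolding has_field_derivative_iff tendsto_at_iff_sequentially comp_def
proof (intro allI impI)
  fix X :: "nat \<Rightarrow> real"
  assume X: "\<forall>i. X i \<in> S - {t}" and lim: "X \<longlonglongrightarrow> t"
  let ?q = "\<lambda>i x. (h (X i) x - h t x) / (X i - t)"
  have meas_q: "?q i \<in> borel_measurable M" for i
    using int X S by (auto intro!: borel_measurable_divide borel_measurable_diff)
  have "(\<lambda>i. \<integral>x. ?q i x \<partial>M) \<longlonglongrightarrow> (\<integral>x. h' t x \<partial>M)"
  proof (rule integral_dominated_convergence[where w = w])
    show "AE x in M. (\<lambda>i. ?q i x) \<longlonglongrightarrow> h' t x"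
      using der[OF S(2)] X lim
      unfolding has_field_derivative_iff tendsto_at_iff_sequentially comp_def by auto
    show "AE x in M. norm (?q i x) \<le> w x" for i
    proof (rule AE_I2)
      fix x
      have "norm (h (X i) x - h t x) \<le> w x * norm (X i - t)"
        using X S by (intro field_differentiable_bound[OF S(1) der]) (auto simp: bound)
      then show "norm (?q i x) \<le> w x"
        using X by (simp add: divide_simps)
    qed
  qed (use meas meas_q w in auto)
  moreover have "(\<integral>x. ?q i x \<partial>M) = ((\<integral>x. h (X i) x \<partial>M) - (\<integral>x. h t x \<partial>M)) / (X i - t)" for i
  proof -
    have "X i \<in> S" using X by auto
    then show ?thesis
      by (simp add: Bochner_Integration.integral_diff[OF int int] S)
  qed
  ultimately show "(\<lambda>i. ((\<integral>x. h (X i) x \<partial>M) - (\<integral>x. h t x \<partial>M)) / (X i - t)) \<longlonglongrightarrow> (\<integral>x. h' t x \<partial>M)"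
    by (simp only:)
qed

lemma integral_of_DERIV_under_integral:
  fixes h h' :: "real \<Rightarrow> 'a \<Rightarrow> real"
  assumes ab: "a \<le> b"
    and int: "\<And>s. s \<in> {a..b} \<Longrightarrow> integrable M (h s)"
    and der: "\<And>s x. s \<in> {a..b} \<Longrightarrow> ((\<lambda>s. h s x) has_real_derivative h' s x) (at s within {a..b})"
    and cont: "\<And>x. continuous_on {a..b} (\<lambda>s. h' s x)"
    and bound: "\<And>s x. s \<in> {a..b} \<Longrightarrow> \<bar>h' s x\<bar> \<le> w x"
    and w: "integrable M w"
    and meas: "\<And>s. s \<in> {a..b} \<Longrightarrow> h' s \<in> borel_measurable M"
  shows "(LBINT s:{a..b}. (\<integral>x. h' s x \<partial>M)) = (\<integral>x. h b x \<partial>M) - (\<integral>x. h a x \<partial>M)"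
  unfolding set_lebesgue_integral_def
proof (rule integral_FTC_Icc[OF ab])
  fix t assume "a \<le> t" "t \<le> b"
  then show "((\<lambda>s. \<integral>x. h s x \<partial>M) has_vector_derivative (\<integral>x. h' t x \<partial>M)) (at t within {a..b})"
    unfolding has_real_derivative_iff_has_vector_derivative[symmetric]
    by (intro DERIV_under_integral[OF _ _ int der bound w meas]) auto
next
  show "continuous_on {a..b} (\<lambda>t. \<integral>x. h' t x \<partial>M)"
  proof (rule continuous_on_sequentiallyI)
    fix X t assume X: "\<forall>n. X n \<in> {a..b}" "t \<in> {a..b}" "X \<longlonglongrightarrow> t"
    show "(\<lambda>n. \<integral>x. h' (X n) x \<partial>M) \<longlonglongrightarrow> (\<integral>x. h' t x \<partial>M)"
    proof (rule integral_dominated_convergence[where w = w])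
      show "AE x in M. (\<lambda>n. h' (X n) x) \<longlonglongrightarrow> h' t x"
        using X continuous_on_tendsto_compose[OF cont X(3,2)] by auto
    qed (use X meas w bound in auto)
  qed
qed

section \<open>The entropy density controls a squared distance\<close>

text \<open>On \<open>{\<delta>..2 * B}\<close> the slope bound gives \<open>\<bar>g \<xi>\<bar> \<ge> c \<bar>\<xi> - a\<bar>\<close>. As \<open>a\<close> has distance at least
  \<open>\<delta>\<close> from both ends of this interval, \<open>\<bar>g\<bar>\<close> is at least \<open>c * \<delta>\<close> at the ends, hence by monotonicity
  also beyond them. The quotient \<open>\<bar>\<xi> - a\<bar> / (\<xi> + a)\<close> is linear near \<open>a\<close> and at most \<open>1\<close>, so a
  multiple of it lies below both bounds.\<close>

lemma decreasing_zero_lower_bound: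
  fixes g g' :: "real \<Rightarrow> real"
  assumes der: "\<And>\<xi>. 0 < \<xi> \<Longrightarrow> (g has_real_derivative g' \<xi>) (at \<xi>)"
    and neg: "\<And>\<xi>. 0 < \<xi> \<Longrightarrow> g' \<xi> < 0"
    and steep: "\<And>\<xi>. \<xi> \<in> {\<delta>..2 * B} \<Longrightarrow> g' \<xi> \<le> - c"
    and pos: "0 < c" "0 < \<delta>" and a: "2 * \<delta> \<le> a" "a \<le> B" and zero: "g a = 0"
    and \<xi>: "0 < \<xi>"
  shows "\<xi> \<le> a \<Longrightarrow> c * \<delta> * ((a - \<xi>) / (\<xi> + a)) \<le> g \<xi>"
    and "a \<le> \<xi> \<Longrightarrow> c * \<delta> * ((\<xi> - a) / (\<xi> + a)) \<le> - g \<xi>"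
proof -
  have mono: "g y \<le> g x" if "0 < x" "x \<le> y" for x y
  proof (rule DERIV_nonpos_imp_nonincreasing[OF that(2)])
    fix z assume "x \<le> z" "z \<le> y"
    with that have "0 < z" by simp
    then show "\<exists>d. (g has_real_derivative d) (at z) \<and> d \<le> 0"
      using der neg by (meson less_imp_le)
  qed
  have slope: "g y + c * y \<le> g x + c * x" if "\<delta> \<le> x" "x \<le> y" "y \<le> 2 * B" for x y
  proof (rule DERIV_nonpos_imp_nonincreasing[OF that(2), of "\<lambda>z. g z + c * z"])
    fix z assume "x \<le> z" "z \<le> y"
    with that pos have "0 < z" "z \<in> {\<delta>..2 * B}" by auto
    then show "\<exists>d. ((\<lambda>z. g z + c * z) has_real_derivative d) (at z) \<and> d \<le> 0"
      using der steep by (intro exI[of _ "g' z + c"]) (fastforce intro!: derivative_eq_intros)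
  qed
  \<comment> \<open>The two alternatives are the regimes near \<open>a\<close> and far from it.\<close>
  have ratio: "c * \<delta> * (d / (\<xi> + a)) \<le> r"
    if "0 \<le> d" "c * d \<le> r \<and> \<delta> \<le> \<xi> + a \<or> c * \<delta> \<le> r \<and> d \<le> \<xi> + a" for d r
    using that(2)
  proof
    assume *: "c * d \<le> r \<and> \<delta> \<le> \<xi> + a"
    have "c * \<delta> * (d / (\<xi> + a)) = c * d * (\<delta> / (\<xi> + a))" by simp
    also have "\<dots> \<le> c * d * 1"
      using * that(1) pos \<xi> a by (intro mult_left_mono) auto
    finally show ?thesis using * by simp
  next
    assume *: "c * \<delta> \<le> r \<and> d \<le> \<xi> + a"
    have "c * \<delta> * (d / (\<xi> + a)) \<le> c * \<delta> * 1"
      using * that(1) pos \<xi> a by (intro mult_left_mono) auto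
    then show ?thesis using * by simp
  qed
  show "c * \<delta> * ((a - \<xi>) / (\<xi> + a)) \<le> g \<xi>" if "\<xi> \<le> a"
  proof (rule ratio)
    show "c * (a - \<xi>) \<le> g \<xi> \<and> \<delta> \<le> \<xi> + a \<or> c * \<delta> \<le> g \<xi> \<and> a - \<xi> \<le> \<xi> + a"
    proof (cases "\<delta> \<le> \<xi>")
      case True
      then show ?thesis
        using slope[of \<xi> a] that a pos \<xi> zero by (auto simp: algebra_simps)
    next
      case False
      have "c * (2 * \<delta>) \<le> c * a" using a(1) pos(1) by (intro mult_left_mono) auto
      moreover have "c * a \<le> g \<delta> + c * \<delta>" using slope[of \<delta> a] a pos zero by simp
      ultimately have "c * \<delta> \<le> g \<delta>" by (simp add: mult.left_commute[of c])
      also have "\<dots> \<le> g \<xi>" using False \<xi> by (intro mono) auto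
      finally show ?thesis using \<xi> by auto
    qed
  qed (use that in auto)
  show "c * \<delta> * ((\<xi> - a) / (\<xi> + a)) \<le> - g \<xi>" if "a \<le> \<xi>"
  proof (rule ratio)
    show "c * (\<xi> - a) \<le> - g \<xi> \<and> \<delta> \<le> \<xi> + a \<or> c * \<delta> \<le> - g \<xi> \<and> \<xi> - a \<le> \<xi> + a"
    proof (cases "\<xi> \<le> 2 * B")
      case True
      then show ?thesis
        using slope[of a \<xi>] that a pos \<xi> zero by (auto simp: algebra_simps)
    next
      case False
      have "c * (a + \<delta>) \<le> c * (2 * B)" using a pos by (intro mult_left_mono) auto
      moreover have "g (2 * B) + c * (2 * B) \<le> c * a" using slope[of a "2 * B"] a pos zero by simp
      ultimately have "c * \<delta> \<le> - g (2 * B)" by (simp add: distrib_left)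
      also have "\<dots> \<le> - g \<xi>" using False a pos mono[of "2 * B" \<xi>] by auto
      finally show ?thesis using a pos by auto
    qed
  qed (use that in auto)
qed

text \<open>The derivative of \<open>(\<xi> - a)\<^sup>2 / (\<xi> + a)\<close> is \<open>(\<xi> - a) / (\<xi> + a)\<close> times the factor
  \<open>(\<xi> + 3 * a) / (\<xi> + a)\<close>, which is at most \<open>3\<close>; so the hypotheses compare \<open>g\<close> with this
  derivative, and the fundamental theorem of calculus evaluates the integral of the latter.
  Integrability of \<open>g\<close> up to zero is what makes \<open>u = 0\<close> admissible, where \<open>g\<close> may be singular.\<close>

lemma interval_integral_upper_bound:
  fixes g :: "real \<Rightarrow> real"
  assumes a: "0 < a" and k: "0 \<le> k" and u: "0 \<le> u"
    and low: "\<And>\<xi>. 0 < \<xi> \<Longrightarrow> \<xi> \<le> a \<Longrightarrow> k * ((a - \<xi>) / (\<xi> + a)) \<le> g \<xi>"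
    and high: "\<And>\<xi>. a \<le> \<xi> \<Longrightarrow> k * ((\<xi> - a) / (\<xi> + a)) \<le> - g \<xi>"
    and int: "\<And>R. set_integrable lborel {0<..<R} g"
  shows "k / 3 * ((u - a)\<^sup>2 / (u + a)) \<le> - (LBINT \<xi>=ereal a..ereal u. g \<xi>)"
proof -
  define p where "p \<xi> = k / 3 * ((\<xi> - a) * (\<xi> + 3 * a) / (\<xi> + a)\<^sup>2)" for \<xi>
  define P where "P \<xi> = k / 3 * ((\<xi> - a)\<^sup>2 / (\<xi> + a))" for \<xi>
  have P: "(P has_vector_derivative p \<xi>) (at \<xi> within A)" if "0 \<le> \<xi>" for \<xi> A
  proof -
    have "(P has_real_derivative p \<xi>) (at \<xi>)"
      unfolding P_def p_def using that a
      by (auto intro!: derivative_eq_intros simp: divide_simps power2_eq_square) (simp add: algebra_simps)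
    then show ?thesis
      by (auto simp: has_real_derivative_iff_has_vector_derivative intro: has_vector_derivative_at_within)
  qed
  have cont: "continuous_on {0..} p"
    unfolding p_def using a by (auto intro!: continuous_intros)
  have P_int: "(LBINT \<xi>=a..u. p \<xi>) = P u"
    using a u by (subst interval_integral_FTC_finite[of a u p P])
       (auto intro!: P continuous_on_subset[OF cont] simp: P_def)
  have int_p: "set_integrable lborel {r<..<s} p" if "0 \<le> r" for r s
    by (rule set_integrable_subset[OF borel_integrable_atLeastAtMost'[of r s]])
       (use that in \<open>auto intro!: continuous_on_subset[OF cont]\<close>)
  have int_g: "set_integrable lborel {r<..<s} g" if "0 \<le> r" for r s
    by (rule set_integrable_subset[OF int[of s]]) (use that in auto)
  have minus: "set_integrable lborel A (\<lambda>\<xi>. - q \<xi>)" if "set_integrable lborel A q"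
    for A and q :: "real \<Rightarrow> real"
    using that by (simp add: set_integrable_def)
  have frac: "(\<xi> + 3 * a) / (\<xi> + a) \<le> 3" if "0 < \<xi>" for \<xi>
    using that a by (simp add: divide_simps)
  have p_eq: "p \<xi> = k * ((\<xi> - a) / (\<xi> + a)) * ((\<xi> + 3 * a) / (\<xi> + a) / 3)" for \<xi>
    by (simp add: p_def power2_eq_square mult_ac)
  have "P u \<le> - (LBINT \<xi>=a..u. g \<xi>)"
  proof (cases "a \<le> u")
    case True
    have "p \<xi> \<le> - g \<xi>" if "a \<le> \<xi>" for \<xi>
    proof -
      have "p \<xi> \<le> k * ((\<xi> - a) / (\<xi> + a)) * 1"
        unfolding p_eq using that a k frac[of \<xi>] by (intro mult_left_mono) auto
      then show ?thesis using high[OF that] by simp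
    qed
    then have "(LBINT \<xi>:{a<..<u}. p \<xi>) \<le> (LBINT \<xi>:{a<..<u}. - g \<xi>)"
      using a by (intro set_integral_mono minus int_p int_g) auto
    then show ?thesis
      using True P_int set_integral_uminus[OF int_g[of a u]] a
      by (simp add: interval_lebesgue_integral_def)
  next
    case False
    have "- p \<xi> \<le> g \<xi>" if "0 < \<xi>" "\<xi> \<le> a" for \<xi>
    proof -
      have "- p \<xi> = k * ((a - \<xi>) / (\<xi> + a)) * ((\<xi> + 3 * a) / (\<xi> + a) / 3)"
        unfolding p_eq by (simp add: divide_simps) (simp add: algebra_simps)
      also have "\<dots> \<le> k * ((a - \<xi>) / (\<xi> + a)) * 1"
        using that a k frac[of \<xi>] by (intro mult_left_mono) auto
      finally show ?thesis using low[OF that] by simp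
    qed
    then have "(LBINT \<xi>:{u<..<a}. - p \<xi>) \<le> (LBINT \<xi>:{u<..<a}. g \<xi>)"
      using a u by (intro set_integral_mono minus int_p int_g) auto
    then show ?thesis
      using False P_int set_integral_uminus[OF int_p[of u a]] u
      by (simp add: interval_lebesgue_integral_def)
  qed
  then show ?thesis by (simp add: P_def)
qed

lemma C2_on_derivative:
  assumes "C2_on S g"
  obtains g' where "\<And>x. x \<in> S \<Longrightarrow> (g has_derivative blinfun_apply (g' x)) (at x)"
    "continuous_on S g'"
proof -
  from assms obtain g' where g': "\<forall>x\<in>S. (g has_derivative blinfun_apply (g' x)) (at x)" "C1_on S g'"
    unfolding C2_on_def by blast
  then have "continuous_on S g'"
    unfolding C1_on_def by (meson continuous_at_imp_continuous_on has_derivative_continuous)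
  with g' show ?thesis using that by blast
qed

text \<open>The \<open>u\<close>-derivative is a continuous function of the periodic lift, so it attains a maximum, which
  is negative, over the product of the unit cube with a compact interval of positive numbers.\<close>

lemma partial_derivative_steep:
  fixes f :: "'n::finite torus \<Rightarrow> real \<Rightarrow> real"
  assumes C2: "C2_on (UNIV \<times> {0<..}) (\<lambda>(y, u). f (torus_proj y) u)"
    and neg: "\<And>x u. 0 < u \<Longrightarrow> deriv (f x) u < 0"
  shows "\<And>x u. 0 < u \<Longrightarrow> (f x has_real_derivative deriv (f x) u) (at u)"
    and "0 < \<delta> \<Longrightarrow> \<exists>c>0. \<forall>x. \<forall>u\<in>{\<delta>..R}. deriv (f x) u \<le> - c"
proof -
  obtain F where F: "\<And>z. z \<in> UNIV \<times> {0<..} \<Longrightarrow>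
      ((\<lambda>(y, u). f (torus_proj y) u) has_derivative blinfun_apply (F z)) (at z)"
    and cont: "continuous_on (UNIV \<times> {0<..}) F"
    using C2_on_derivative[OF C2] by blast
  have der: "(f (torus_proj y) has_real_derivative F (y, u) (0, 1)) (at u)" if "0 < u" for y u
  proof -
    have 1: "((\<lambda>s. (y, s)) has_derivative (\<lambda>h. (0, h))) (at u)"
      by (auto intro!: derivative_eq_intros)
    have "((\<lambda>(y, u). f (torus_proj y) u) has_derivative blinfun_apply (F (y, u))) (at (y, u))"
      using F that by simp
    from has_derivative_compose[OF 1 this]
    have "(f (torus_proj y) has_derivative (\<lambda>h. F (y, u) (0, h))) (at u)" by simp
    moreover have "(\<lambda>h. F (y, u) (0, h)) = (*) (F (y, u) (0, 1))"
    proof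
      show "F (y, u) (0, h) = F (y, u) (0, 1) * h" for h
        using blinfun.scaleR_right[of "F (y, u)" h "(0, 1)"] by simp
    qed
    ultimately show ?thesis
      by (simp only: has_field_derivative_def)
  qed
  then have deriv_eq: "deriv (f (torus_proj y)) u = F (y, u) (0, 1)" if "0 < u" for y u
    using that by (blast intro: DERIV_imp_deriv)
  show "(f x has_real_derivative deriv (f x) u) (at u)" if "0 < u" for x u
  proof -
    obtain y where "torus_proj y = x" using torus_representative .
    with der[OF that, of y] deriv_eq[OF that, of y] show ?thesis by simp
  qed
  show "\<exists>c>0. \<forall>x. \<forall>u\<in>{\<delta>..R}. deriv (f x) u \<le> - c" if "0 < \<delta>"
  proof (cases "\<delta> \<le> R")
    case True
    let ?K = "cbox (0 :: real ^ 'n) 1 \<times> {\<delta>..R}"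
    have "continuous_on ?K (\<lambda>z. F z (0, 1))"
      using that by (intro continuous_intros continuous_on_subset[OF cont]) auto
    moreover have "compact ?K" by (intro compact_Times) auto
    moreover have "(0, \<delta>) \<in> ?K" using True by (auto simp: mem_box_cart)
    ultimately obtain z where z: "z \<in> ?K" "\<And>w. w \<in> ?K \<Longrightarrow> F w (0, 1) \<le> F z (0, 1)"
      using continuous_attains_sup[of ?K "\<lambda>z. F z (0, 1)"] by blast
    obtain y s where "z = (y, s)" by (cases z)
    with z(1) that have ys: "z = (y, s)" "0 < s" by auto
    have "F z (0, 1) < 0"
      using neg[OF ys(2), of "torus_proj y"] deriv_eq[OF ys(2), of y] ys by simp
    moreover have "deriv (f x) u \<le> F z (0, 1)" if u: "u \<in> {\<delta>..R}" for x u
    proof -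
      obtain y where y: "y \<in> cbox 0 1" "torus_proj y = x" using torus_representative .
      have "0 < u" using u \<open>0 < \<delta>\<close> by simp
      with deriv_eq[of u y] z(2)[of "(y, u)"] y u show ?thesis by simp
    qed
    ultimately show ?thesis by (intro exI[of _ "- F z (0, 1)"]) auto
  qed (auto intro: exI[of _ 1])
qed

lemma integrable_near_zero:
  fixes g g1 :: "real \<Rightarrow> real"
  assumes cont: "continuous_on {0<..} g"
    and g1: "g1 absolutely_integrable_on {0..R}"
    and bound: "AE u in lebesgue. 0 < u \<longrightarrow> \<bar>g u\<bar> \<le> g1 u"
  shows "set_integrable lborel {0<..<R} g"
proof -
  have meas: "(\<lambda>u. indicator {0<..<R} u *\<^sub>R g u) \<in> borel_measurable lborel"
    using borel_measurable_continuous_on_indicator[of "{0<..<R}" g] continuous_on_subset[OF cont]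
    by (auto simp: greaterThanLessThan_eq)
  have "integrable lebesgue (\<lambda>u. indicator {0<..<R} u *\<^sub>R g u)"
  proof (rule Bochner_Integration.integrable_bound)
    show "integrable lebesgue (\<lambda>u. indicator {0..R} u *\<^sub>R g1 u)"
      using g1 by (simp add: set_integrable_def)
    show "(\<lambda>u. indicator {0<..<R} u *\<^sub>R g u) \<in> borel_measurable lebesgue"
      by (rule measurable_completion[OF meas])
    show "AE u in lebesgue. norm (indicator {0<..<R} u *\<^sub>R g u) \<le> norm (indicator {0..R} u *\<^sub>R g1 u)"
      using bound by eventually_elim (auto split: split_indicator)
  qed
  then show ?thesis
    unfolding set_integrable_def using meas integrable_completion by blast
qed

text \<open>With \<open>2 * \<delta>\<close> the minimum of \<open>m\<close> and the interval \<open>{\<delta>..2 * max m}\<close>, every \<open>m x\<close> stays away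
  from the ends by at least \<open>\<delta>\<close>, and the constants of the one-dimensional bounds do not depend on \<open>x\<close>.\<close>

lemma entropy_density_lower_bound:
  fixes f :: "'n::finite torus \<Rightarrow> real \<Rightarrow> real" and m :: "'n torus \<Rightarrow> real"
    and g1 :: "real \<Rightarrow> real"
  assumes f_C2: "C2_on (UNIV \<times> {0<..}) (\<lambda>(y, u). f (torus_proj y) u)"
    and fu_neg: "\<And>x u. 0 < u \<Longrightarrow> deriv (f x) u < 0"
    and g1_L1_loc: "\<And>R. g1 absolutely_integrable_on {0..R}"
    and f_bound: "AE u in lebesgue. 0 < u \<longrightarrow> (\<forall>x. \<bar>f x u\<bar> \<le> g1 u)"
    and m_pos: "\<And>x. 0 < m x"
    and m_cont: "continuous_on UNIV m"
    and f_m: "\<And>x. f x (m x) = 0"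
  obtains \<kappa> where "0 < \<kappa>"
    "\<And>x u. 0 \<le> u \<Longrightarrow> \<kappa> * ((u - m x)\<^sup>2 / (u + m x)) \<le> entropy_density f m x u"
proof -
  obtain xl where xl: "\<And>x. m xl \<le> m x"
    using continuous_attains_inf[OF compact_torus _ m_cont] by auto
  obtain xu where xu: "\<And>x. m x \<le> m xu"
    using continuous_attains_sup[OF compact_torus _ m_cont] by auto
  define \<delta> where "\<delta> = m xl / 2"
  have \<delta>: "0 < \<delta>" "\<And>x. 2 * \<delta> \<le> m x" using m_pos xl by (auto simp: \<delta>_def)
  obtain c where c: "0 < c" "\<And>x u. u \<in> {\<delta>..2 * m xu} \<Longrightarrow> deriv (f x) u \<le> - c"
    using partial_derivative_steep(2)[OF f_C2 fu_neg \<delta>(1)] by blast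
  note der = partial_derivative_steep(1)[OF f_C2 fu_neg]
  show ?thesis
  proof
    show "0 < c * \<delta> / 3" using c \<delta> by simp
    fix x and u :: real assume u: "0 \<le> u"
    have low: "c * \<delta> * ((m x - \<xi>) / (\<xi> + m x)) \<le> f x \<xi>" if "0 < \<xi>" "\<xi> \<le> m x" for \<xi>
      by (rule decreasing_zero_lower_bound(1)[where g' = "deriv (f x)" and B = "m xu"])
         (use that der fu_neg c \<delta> xu f_m in auto)
    have high: "c * \<delta> * ((\<xi> - m x) / (\<xi> + m x)) \<le> - f x \<xi>" if "m x \<le> \<xi>" for \<xi>
      by (rule decreasing_zero_lower_bound(2)[where g' = "deriv (f x)" and B = "m xu"])
         (use that der fu_neg c \<delta> xu f_m less_le_trans[OF m_pos that] in auto)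
    have "continuous_on {0<..} (f x)"
      using der by (intro continuous_at_imp_continuous_on) (auto intro: DERIV_isCont)
    moreover have "AE u in lebesgue. 0 < u \<longrightarrow> \<bar>f x u\<bar> \<le> g1 u"
      using f_bound by eventually_elim auto
    ultimately have "set_integrable lborel {0<..<R} (f x)" for R
      using integrable_near_zero g1_L1_loc by blast
    then show "c * \<delta> / 3 * ((u - m x)\<^sup>2 / (u + m x)) \<le> entropy_density f m x u"
      unfolding entropy_density_def
      using c \<delta> by (intro interval_integral_upper_bound m_pos u low high) auto
  qed
qed

section \<open>Linear interpolation of densities\<close>

lemma prob_density_measure:
  assumes "prob_density u"
  shows "density_measure u \<in> torus_prob_measures"
proof -
  have "emeasure (density_measure u) UNIV = (\<integral>\<^sup>+x. ennreal (u x) \<partial>torus_lborel)"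
    using assms unfolding density_measure_def
    by (subst emeasure_density) (auto simp: prob_density_def)
  also have "\<dots> = 1"
    using assms by (simp add: prob_density_def nn_integral_eq_integral)
  finally show ?thesis
    by (auto simp: torus_prob_measures_def density_measure_def intro!: prob_spaceI)
qed

definition smoothstep :: "real \<Rightarrow> real" where
  "smoothstep t = t\<^sup>2 * (3 - 2 * t)"

definition smoothstep_deriv :: "real \<Rightarrow> real" where
  "smoothstep_deriv t = 6 * t * (1 - t)"

lemma smoothstep_simps [simp]:
  "smoothstep 0 = 0" "smoothstep 1 = 1" "smoothstep_deriv 0 = 0"
  by (simp_all add: smoothstep_def smoothstep_deriv_def)

text \<open>The quadratic lower bounds match the linear vanishing of \<open>smoothstep_deriv\<close> at both ends.\<close>

lemma smoothstep_bounds: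
  assumes "t \<in> {0..1}"
  shows "t\<^sup>2 \<le> smoothstep t" "(1 - t)\<^sup>2 \<le> 1 - smoothstep t"
    "0 \<le> smoothstep t" "smoothstep t \<le> 1"
proof -
  have "t\<^sup>2 * 1 \<le> t\<^sup>2 * (3 - 2 * t)"
    using assms by (intro mult_left_mono) auto
  then show 1: "t\<^sup>2 \<le> smoothstep t" by (simp add: smoothstep_def)
  have "(1 - t)\<^sup>2 * 1 \<le> (1 - t)\<^sup>2 * (1 + 2 * t)"
    using assms by (intro mult_left_mono) auto
  also have "\<dots> = 1 - smoothstep t"
    by (simp add: smoothstep_def power2_eq_square algebra_simps)
  finally show 2: "(1 - t)\<^sup>2 \<le> 1 - smoothstep t" by simp
  show "0 \<le> smoothstep t" using 1 order_trans zero_le_power2 by blast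
  show "smoothstep t \<le> 1" using 2 zero_le_power2[of "1 - t"] by linarith
qed

lemma smoothstep_DERIV: "(smoothstep has_real_derivative smoothstep_deriv t) (at t within S)"
  unfolding smoothstep_def[abs_def] smoothstep_deriv_def
  by (auto intro!: derivative_eq_intros simp: power2_eq_square algebra_simps)

lemma abs_smoothstep_deriv_le: "t \<in> {0..1} \<Longrightarrow> \<bar>smoothstep_deriv t\<bar> \<le> 6"
  by (auto simp: smoothstep_deriv_def abs_mult mult_le_one)

lemma continuous_on_smoothstep [continuous_intros]:
  "continuous_on S smoothstep" "continuous_on S smoothstep_deriv"
  unfolding smoothstep_def[abs_def] smoothstep_deriv_def[abs_def] by (intro continuous_intros)+

definition interpolate :: "('a \<Rightarrow> real) \<Rightarrow> ('a \<Rightarrow> real) \<Rightarrow> real \<Rightarrow> 'a \<Rightarrow> real" where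
  "interpolate u m t x = (1 - smoothstep t) * u x + smoothstep t * m x"

definition growth_rate :: "('a \<Rightarrow> real) \<Rightarrow> ('a \<Rightarrow> real) \<Rightarrow> real \<Rightarrow> 'a \<Rightarrow> real" where
  "growth_rate u m t x = smoothstep_deriv t * (m x - u x) / interpolate u m t x"

lemma interpolate_bounds:
  assumes "0 \<le> u x" "0 < m x" "t \<in> {0..1}"
  shows "0 \<le> interpolate u m t x" "interpolate u m t x \<le> u x + m x"
    "t \<noteq> 0 \<Longrightarrow> 0 < interpolate u m t x"
proof -
  note s = smoothstep_bounds[OF assms(3)]
  show "0 \<le> interpolate u m t x"
    using s assms by (simp add: interpolate_def)
  have "(1 - smoothstep t) * u x \<le> 1 * u x" "smoothstep t * m x \<le> 1 * m x"
    using s assms by (intro mult_right_mono; simp)+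
  then show "interpolate u m t x \<le> u x + m x"
    by (simp add: interpolate_def)
  assume "t \<noteq> 0"
  then have "0 < smoothstep t" using s(1) by (smt (verit) zero_less_power2)
  then show "0 < interpolate u m t x"
    using s assms by (simp add: interpolate_def add_nonneg_pos)
qed

text \<open>The denominator of \<open>growth_rate\<close> can only vanish at \<open>t = 0\<close>, where \<open>smoothstep_deriv\<close> does as
  well.\<close>

lemma interpolate_growth_rate:
  assumes "0 \<le> u x" "0 < m x" "t \<in> {0..1}"
  shows "interpolate u m t x * growth_rate u m t x = smoothstep_deriv t * (m x - u x)"
  using interpolate_bounds(3)[where u = u and m = m, OF assms] by (cases "t = 0") (auto simp: growth_rate_def)

text \<open>Since \<open>(t * (1 - t))\<^sup>2\<close> is at most \<open>t\<^sup>2\<close> and at most \<open>(1 - t)\<^sup>2\<close>, it bounds both weights of the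
  interpolation from below. So the numerator \<open>36 * (t * (1 - t))\<^sup>2\<close> of the action absorbs the
  degeneration of the denominator at either end.\<close>

lemma interpolate_action_bound:
  assumes u: "0 \<le> u x" and m: "0 < m x" and t: "t \<in> {0..1}"
  shows "interpolate u m t x * (growth_rate u m t x)\<^sup>2 \<le> 36 * ((u x - m x)\<^sup>2 / (u x + m x))"
proof (cases "t = 0")
  case True
  then show ?thesis using u m by (simp add: growth_rate_def)
next
  case False
  let ?I = "interpolate u m t x"
  have I: "0 < ?I" using interpolate_bounds(3)[where u = u and m = m, OF assms False] .
  have "(t * (1 - t))\<^sup>2 * u x \<le> (1 - t)\<^sup>2 * u x"
    using t u by (intro mult_right_mono power_mono) (auto simp: mult_left_le_one_le)
  moreover have "(t * (1 - t))\<^sup>2 * m x \<le> t\<^sup>2 * m x"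
    using t m by (intro mult_right_mono power_mono) (auto simp: mult_left_le)
  moreover have "(1 - t)\<^sup>2 * u x \<le> (1 - smoothstep t) * u x" "t\<^sup>2 * m x \<le> smoothstep t * m x"
    using smoothstep_bounds[OF t] u m by (intro mult_right_mono; simp)+
  ultimately have key: "(t * (1 - t))\<^sup>2 * (u x + m x) \<le> ?I"
    by (simp add: interpolate_def distrib_left)
  have "?I * (growth_rate u m t x)\<^sup>2 = 36 * (u x - m x)\<^sup>2 * ((t * (1 - t))\<^sup>2 / ?I)"
    using I by (simp add: growth_rate_def smoothstep_deriv_def power2_eq_square divide_simps)
      (simp add: algebra_simps)
  also have "\<dots> \<le> 36 * (u x - m x)\<^sup>2 * (1 / (u x + m x))"
    using key I u m by (intro mult_left_mono) (auto simp: divide_simps)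
  finally show ?thesis by simp
qed

section \<open>The interpolation is an admissible curve\<close>

lemma test_function_time_derivative:
  fixes \<phi> :: "real \<Rightarrow> 'n::finite torus \<Rightarrow> real"
  assumes "test_function \<phi>"
  shows "\<And>t x. ((\<lambda>s. \<phi> s x) has_real_derivative deriv (\<lambda>s. \<phi> s x) t) (at t)"
    and "continuous_on UNIV (\<lambda>(t, y). \<phi> t (torus_proj y))"
    and "continuous_on UNIV (\<lambda>(t, y). deriv (\<lambda>s. \<phi> s (torus_proj y)) t)"
    and "\<And>x. \<phi> 0 x = 0" "\<And>x. \<phi> 1 x = 0"
proof -
  obtain F where F: "\<And>z. ((\<lambda>(t, y). \<phi> t (torus_proj y)) has_derivative blinfun_apply (F z)) (at z)"
    and cont: "continuous_on UNIV F"
    using assms unfolding test_function_def C1_on_def by blast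
  have der: "((\<lambda>s. \<phi> s (torus_proj y)) has_real_derivative F (t, y) (1, 0)) (at t)" for t y
  proof -
    have 1: "((\<lambda>s. (s, y)) has_derivative (\<lambda>h. (h, 0))) (at t)"
      by (auto intro!: derivative_eq_intros)
    from has_derivative_compose[OF 1 F]
    have "((\<lambda>s. \<phi> s (torus_proj y)) has_derivative (\<lambda>h. F (t, y) (h, 0))) (at t)" by simp
    moreover have "(\<lambda>h. F (t, y) (h, 0)) = (*) (F (t, y) (1, 0))"
    proof
      show "F (t, y) (h, 0) = F (t, y) (1, 0) * h" for h
        using blinfun.scaleR_right[of "F (t, y)" h "(1, 0)"] by simp
    qed
    ultimately show ?thesis
      by (simp only: has_field_derivative_def)
  qed
  have deriv_eq: "deriv (\<lambda>s. \<phi> s (torus_proj y)) t = F (t, y) (1, 0)" for t y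
    using der by (rule DERIV_imp_deriv)
  show "((\<lambda>s. \<phi> s x) has_real_derivative deriv (\<lambda>s. \<phi> s x) t) (at t)" for t x
  proof -
    obtain y where "torus_proj y = x" using torus_representative .
    with der[of y t] deriv_eq[of y t] show ?thesis by simp
  qed
  show "continuous_on UNIV (\<lambda>(t, y). \<phi> t (torus_proj y))"
    using F by (intro continuous_at_imp_continuous_on ballI has_derivative_continuous)
  have "continuous_on UNIV (\<lambda>z. F z (1, 0))"
    by (intro continuous_intros cont)
  then show "continuous_on UNIV (\<lambda>(t, y). deriv (\<lambda>s. \<phi> s (torus_proj y)) t)"
    by (simp add: deriv_eq case_prod_beta')
  obtain a b where ab: "0 < a" "b < 1" "\<forall>t. t \<notin> {a..b} \<longrightarrow> (\<forall>x. \<phi> t x = 0)"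
    using assms unfolding test_function_def by blast
  show "\<phi> 0 x = 0" "\<phi> 1 x = 0" for x using ab by auto
qed

lemma borel_measurable_torus_slice:
  fixes \<Phi> :: "real \<Rightarrow> 'n::finite torus \<Rightarrow> real"
  assumes "continuous_on UNIV (\<lambda>(t, y). \<Phi> t (torus_proj y))"
  shows "\<Phi> t \<in> borel_measurable borel"
proof (intro borel_measurable_continuous_onI continuous_on_torus)
  show "continuous_on UNIV (\<lambda>y. \<Phi> t (torus_proj y))"
    by (rule continuous_on_compose2[OF assms, of UNIV "Pair t", simplified])
      (intro continuous_on_Pair continuous_on_const continuous_on_id)
qed

context
  fixes u m :: "'n::finite torus \<Rightarrow> real"
  assumes u: "prob_density u" "\<And>x. 0 \<le> u x"
    and m: "prob_density m" "\<And>x. 0 < m x"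
begin

lemma integrable_densities: "integrable torus_lborel u" "integrable torus_lborel m"
  using u m by (auto simp: prob_density_def)

lemma measurable_densities [measurable]:
  "u \<in> borel_measurable borel" "m \<in> borel_measurable borel"
  using integrable_densities[THEN borel_measurable_integrable] by simp_all

lemma measurable_interpolate [measurable]: "interpolate u m t \<in> borel_measurable borel"
  unfolding interpolate_def[abs_def] by measurable

lemma integrable_interpolate: "integrable torus_lborel (interpolate u m t)"
  unfolding interpolate_def[abs_def] using integrable_densities by simp

lemma prob_density_interpolate:
  assumes "t \<in> {0..1}"
  shows "prob_density (interpolate u m t)"
proof -
  have "(\<integral>x. interpolate u m t x \<partial>torus_lborel) = (1 - smoothstep t) * 1 + smoothstep t * 1"
    unfolding interpolate_def[abs_def] using integrable_densities u m by (simp add: prob_density_def)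
  then show ?thesis
    using integrable_interpolate interpolate_bounds(1)[where u = u and m = m] u m assms
    by (auto simp: prob_density_def)
qed

lemma integral_interpolate:
  assumes "t \<in> {0..1}" and "\<psi> \<in> borel_measurable borel"
  shows "(\<integral>x. \<psi> x \<partial>density_measure (interpolate u m t)) =
    (\<integral>x. interpolate u m t x * \<psi> x \<partial>torus_lborel)"
  unfolding density_measure_def using assms interpolate_bounds(1)[where u = u and m = m] u m
  by (subst integral_density) auto

lemma weakly_continuous_interpolate:
  "weakly_continuous_curve (\<lambda>t. density_measure (interpolate u m t))"
  unfolding weakly_continuous_curve_def
proof (intro conjI ballI allI impI)
  show "density_measure (interpolate u m t) \<in> torus_prob_measures" if "t \<in> {0..1}" for t
    by (intro prob_density_measure prob_density_interpolate that)
  fix \<psi> :: "'n torus \<Rightarrow> real" assume \<psi>: "continuous_on UNIV \<psi>"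
  then have [measurable]: "\<psi> \<in> borel_measurable borel"
    by (rule borel_measurable_continuous_onI)
  have "bounded (range \<psi>)"
    using compact_continuous_image[OF \<psi> compact_torus] by (rule compact_imp_bounded)
  then obtain K where K: "\<And>x. \<bar>\<psi> x\<bar> \<le> K" by (auto simp: bounded_iff)
  have int: "integrable torus_lborel (\<lambda>x. w x * \<psi> x)"
    if w: "integrable torus_lborel w" for w
  proof (rule Bochner_Integration.integrable_bound[of _ "\<lambda>x. K * w x"])
    show "AE x in torus_lborel. norm (w x * \<psi> x) \<le> norm (K * w x)"
      using K abs_ge_self[of K] by (intro AE_I2) (auto simp: abs_mult mult.commute[of "\<bar>w _\<bar>"] intro!: mult_right_mono intro: order_trans)
  qed (use w in auto)
  have "(\<integral>x. \<psi> x \<partial>density_measure (interpolate u m t)) =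
      (1 - smoothstep t) * (\<integral>x. u x * \<psi> x \<partial>torus_lborel) + smoothstep t * (\<integral>x. m x * \<psi> x \<partial>torus_lborel)"
    if "t \<in> {0..1}" for t
    using int integrable_densities that
    by (simp add: integral_interpolate interpolate_def distrib_right mult.assoc)
  then show "continuous_on {0..1} (\<lambda>t. \<integral>x. \<psi> x \<partial>density_measure (interpolate u m t))"
    by (subst continuous_on_cong[OF refl]) (assumption, intro continuous_intros)
qed

text \<open>After multiplication by the density, the integrand is the time derivative of
  \<open>interpolate u m t x * \<phi> t x\<close>. The time integral therefore is a difference of boundary values,
  which vanish because \<open>\<phi>\<close> does at both ends.\<close>

lemma interpolate_continuity_equation:
  "weak_continuity_reaction_eq (\<lambda>t. density_measure (interpolate u m t)) (growth_rate u m) (\<lambda>_ _. 0)"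
  unfolding weak_continuity_reaction_eq_def
proof (intro allI impI)
  fix \<phi> :: "real \<Rightarrow> 'n torus \<Rightarrow> real" assume "test_function \<phi>"
  note \<phi> = test_function_time_derivative[OF this]
  let ?D = "\<lambda>t x. deriv (\<lambda>s. \<phi> s x) t"
  define h where "h t x = interpolate u m t x * \<phi> t x" for t x
  define h' where "h' t x = interpolate u m t x * ?D t x + smoothstep_deriv t * (m x - u x) * \<phi> t x" for t x
  have [measurable]: "\<phi> t \<in> borel_measurable borel" "?D t \<in> borel_measurable borel" for t
    using borel_measurable_torus_slice[OF \<phi>(2)] borel_measurable_torus_slice[OF \<phi>(3)] by auto
  obtain K where K: "0 \<le> K" "\<And>t x. t \<in> {0..1} \<Longrightarrow> \<bar>\<phi> t x\<bar> \<le> K"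
    using torus_pair_bound[OF \<phi>(2)] by blast
  obtain L where L: "0 \<le> L" "\<And>t x. t \<in> {0..1} \<Longrightarrow> \<bar>?D t x\<bar> \<le> L"
    using torus_pair_bound[OF \<phi>(3)] by blast
  have I: "\<bar>interpolate u m t x\<bar> \<le> u x + m x" if "t \<in> {0..1}" for t x
    using interpolate_bounds(1,2)[of u x m t] u m that by simp
  have "(\<integral>x. ?D t x + 0 \<bullet> torus_grad (\<phi> t) x + growth_rate u m t x * \<phi> t x
      \<partial>density_measure (interpolate u m t)) = (\<integral>x. h' t x \<partial>torus_lborel)" if t: "t \<in> {0..1}" for t
  proof -
    have [measurable]: "growth_rate u m t \<in> borel_measurable borel"
      unfolding growth_rate_def[abs_def] by measurable
    show ?thesis
      using interpolate_growth_rate[where u = u and m = m] u m t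
      by (subst integral_interpolate) (auto simp: h'_def[abs_def] distrib_left mult.assoc[symmetric])
  qed
  then have "(LBINT t:{0..1}. (\<integral>x. ?D t x + 0 \<bullet> torus_grad (\<phi> t) x + growth_rate u m t x * \<phi> t x
      \<partial>density_measure (interpolate u m t))) = (LBINT t:{0..1}. (\<integral>x. h' t x \<partial>torus_lborel))"
    by (intro set_lebesgue_integral_cong) auto
  also have "\<dots> = (\<integral>x. h 1 x \<partial>torus_lborel) - (\<integral>x. h 0 x \<partial>torus_lborel)"
  proof (rule integral_of_DERIV_under_integral[where w = "\<lambda>x. (L + 6 * K) * (u x + m x)"])
    show "integrable torus_lborel (h t)" if "t \<in> {0..1}" for t
    proof (rule Bochner_Integration.integrable_bound[of _ "\<lambda>x. (u x + m x) * K"])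
      show "AE x in torus_lborel. norm (h t x) \<le> norm ((u x + m x) * K)"
      proof (rule AE_I2)
        fix x
        have "\<bar>h t x\<bar> \<le> (u x + m x) * K"
          unfolding h_def abs_mult using I[OF that] K(2)[OF that] u(2)[of x] m(2)[of x]
          by (intro mult_mono) auto
        then show "norm (h t x) \<le> norm ((u x + m x) * K)" by simp
      qed
    qed (use integrable_densities in \<open>auto simp: h_def[abs_def]\<close>)
    show "((\<lambda>t. h t x) has_real_derivative h' t x) (at t within {0..1})" for t x
      unfolding h_def h'_def interpolate_def
      by (auto intro!: derivative_eq_intros smoothstep_DERIV DERIV_subset[OF \<phi>(1)] simp: algebra_simps)
    show "continuous_on {0..1} (\<lambda>t. h' t x)" for x
    proof -
      obtain y where y: "torus_proj y = x" using torus_representative .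
      have pair: "continuous_on {0..1 :: real} (\<lambda>t. (t, y))"
        by (intro continuous_on_Pair continuous_on_const continuous_on_id)
      have "continuous_on {0..1} (\<lambda>t. ?D t x)" "continuous_on {0..1} (\<lambda>t. \<phi> t x)"
        using continuous_on_compose2[OF \<phi>(3) pair] continuous_on_compose2[OF \<phi>(2) pair] y by auto
      then show ?thesis
        unfolding h'_def interpolate_def by (intro continuous_intros)
    qed
    show "\<bar>h' t x\<bar> \<le> (L + 6 * K) * (u x + m x)" if t: "t \<in> {0..1}" for t x
    proof -
      have "\<bar>interpolate u m t x * ?D t x\<bar> \<le> (u x + m x) * L"
        unfolding abs_mult using I[OF t] L(2)[OF t] u(2)[of x] m(2)[of x] by (intro mult_mono) auto
      moreover have "\<bar>smoothstep_deriv t * (m x - u x) * \<phi> t x\<bar> \<le> 6 * (u x + m x) * K"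
        unfolding abs_mult using abs_smoothstep_deriv_le[OF t] K(2)[OF t] u(2)[of x] m(2)[of x]
        by (intro mult_mono) auto
      ultimately show ?thesis
        unfolding h'_def by (simp add: algebra_simps)
    qed
  qed (use integrable_densities in \<open>auto simp: h'_def[abs_def]\<close>)
  also have "\<dots> = 0"
    using \<phi>(4,5) by (simp add: h_def)
  finally show "(LBINT t:{0..1}. (\<integral>x. ?D t x + 0 \<bullet> torus_grad (\<phi> t) x + growth_rate u m t x * \<phi> t x
      \<partial>density_measure (interpolate u m t))) = 0" .
qed

lemma interpolate_action_le:
  "hks_action (\<lambda>t. density_measure (interpolate u m t)) (growth_rate u m) (\<lambda>_ _. 0)
    \<le> (\<integral>\<^sup>+x. ennreal (36 * ((u x - m x)\<^sup>2 / (u x + m x))) \<partial>torus_lborel)" (is "_ \<le> ?J")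
proof -
  have "(\<integral>\<^sup>+x. ennreal ((norm (0 :: real ^ 'n))\<^sup>2 + \<bar>growth_rate u m t x\<bar>\<^sup>2) \<partial>density_measure (interpolate u m t)) \<le> ?J"
    if t: "t \<in> {0..1}" for t
  proof -
    have [measurable]: "growth_rate u m t \<in> borel_measurable borel"
      unfolding growth_rate_def[abs_def] by measurable
    have "(\<integral>\<^sup>+x. ennreal ((norm (0 :: real ^ 'n))\<^sup>2 + \<bar>growth_rate u m t x\<bar>\<^sup>2) \<partial>density_measure (interpolate u m t))
        = (\<integral>\<^sup>+x. ennreal (interpolate u m t x) * ennreal ((growth_rate u m t x)\<^sup>2) \<partial>torus_lborel)"
      unfolding density_measure_def by (subst nn_integral_density) auto
    also have "\<dots> \<le> ?J"
      using interpolate_bounds(1)[of u _ m t] interpolate_action_bound[of u _ m t] u m t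
      by (intro nn_integral_mono) (auto simp: ennreal_mult[symmetric] intro!: ennreal_leI)
    finally show ?thesis .
  qed
  then have "hks_action (\<lambda>t. density_measure (interpolate u m t)) (growth_rate u m) (\<lambda>_ _. 0)
      \<le> (\<integral>\<^sup>+t. ?J * indicator {0..1::real} t \<partial>lborel)"
    unfolding hks_action_def by (intro nn_integral_mono) (auto split: split_indicator)
  also have "\<dots> = ?J"
    by (simp add: nn_integral_cmult_indicator)
  finally show ?thesis .
qed

lemma interpolate_square_integrable:
  "hks_square_integrable (\<lambda>t. density_measure (interpolate u m t)) (growth_rate u m) (\<lambda>_ _. 0)"
  unfolding hks_square_integrable_def
proof (intro conjI)
  have [measurable]: "smoothstep \<in> borel_measurable (restrict_space borel {0..1})"
    "smoothstep_deriv \<in> borel_measurable (restrict_space borel {0..1})"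
    by (intro borel_measurable_continuous_on_restrict continuous_intros)+
  show "(\<lambda>(t, x). growth_rate u m t x) \<in> borel_measurable (restrict_space borel {0..1} \<Otimes>\<^sub>M borel)"
    unfolding growth_rate_def interpolate_def by measurable
  have bound: "(u x - m x)\<^sup>2 / (u x + m x) \<le> u x + m x" for x
  proof -
    have "(u x - m x)\<^sup>2 \<le> (u x + m x)\<^sup>2"
      using u(2)[of x] m(2)[of x] by (simp add: power2_eq_square algebra_simps)
    then show ?thesis
      using u(2)[of x] m(2)[of x] by (simp add: divide_simps power2_eq_square)
  qed
  have "hks_action (\<lambda>t. density_measure (interpolate u m t)) (growth_rate u m) (\<lambda>_ _. 0)
      \<le> (\<integral>\<^sup>+x. ennreal (36 * (u x + m x)) \<partial>torus_lborel)"
    using bound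
    by (intro order_trans[OF interpolate_action_le] nn_integral_mono ennreal_leI mult_left_mono) auto
  also have "\<dots> < \<infinity>"
    using integrable_densities u(2) m(2)
    by (subst nn_integral_eq_integral) (auto intro!: AE_I2 add_nonneg_nonneg simp: less_imp_le)
  finally show "hks_action (\<lambda>t. density_measure (interpolate u m t)) (growth_rate u m) (\<lambda>_ _. 0) < \<infinity>" .
qed simp

lemma hks_dist_sq_le:
  "hks_dist_sq (density_measure u) (density_measure m)
    \<le> (\<integral>\<^sup>+x. ennreal (36 * ((u x - m x)\<^sup>2 / (u x + m x))) \<partial>torus_lborel)"
proof -
  have ends: "interpolate u m 0 = u" "interpolate u m 1 = m"
    by (auto simp: interpolate_def)
  have "(\<lambda>t. density_measure (interpolate u m t), growth_rate u m, \<lambda>_ _. 0)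
      \<in> hks_admissible (density_measure u) (density_measure m)"
    using weakly_continuous_interpolate interpolate_square_integrable interpolate_continuity_equation
    by (simp add: hks_admissible_def ends)
  then have "hks_dist_sq (density_measure u) (density_measure m)
      \<le> hks_action (\<lambda>t. density_measure (interpolate u m t)) (growth_rate u m) (\<lambda>_ _. 0)"
    unfolding hks_dist_sq_def by (rule INF_lower2) simp
  then show ?thesis
    using interpolate_action_le by (rule order_trans)
qed

end

section \<open>The entropy controls the spherical Hellinger--Kantorovich distance\<close>

theorem theorem3p17:
  fixes f :: "'n::finite torus \<Rightarrow> real \<Rightarrow> real"
    and m :: "'n torus \<Rightarrow> real"
    and g1 :: "real \<Rightarrow> real"
  assumes f_C2: "C2_on (UNIV \<times> {0<..}) (\<lambda>(y, u). f (torus_proj y) u)"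
    and f_L1_loc: "\<And>R. set_integrable (torus_lborel \<Otimes>\<^sub>M lborel) (UNIV \<times> {0<..R}) (\<lambda>(x, u). f x u)"
    and uf_cont: "continuous_upto_0 (\<lambda>x u. u * f x u)"
    and ufx_cont: "continuous_upto_0 (\<lambda>x u. u *\<^sub>R torus_grad (\<lambda>z. f z u) x)"
    and fu_neg: "\<And>x u. 0 < u \<Longrightarrow> deriv (f x) u < 0"
    and g1_L1_loc: "\<And>R. g1 absolutely_integrable_on {0..R}"
    and f_bound: "AE u in lebesgue. 0 < u \<longrightarrow> (\<forall>x. \<bar>f x u\<bar> \<le> g1 u)"
    and m_pos: "\<And>x. 0 < m x"
    and m_C2: "C2_on UNIV (\<lambda>y. m (torus_proj y))"
    and m_density: "prob_density m"
    and f_m: "\<And>x. f x (m x) = 0"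
    and f_lim: "\<And>K. eventually (\<lambda>u. \<forall>x. f x u \<le> K) at_top"
  shows "\<exists>C::real. 0 < C \<and> (\<forall>u0. prob_density u0 \<and> relative_entropy f m u0 < \<infinity> \<longrightarrow>
           hks_dist_sq (density_measure u0) (density_measure m) \<le> ennreal C * relative_entropy f m u0)"
proof -
  have "continuous_on UNIV (\<lambda>y. m (torus_proj y))"
    using C2_on_derivative[OF m_C2]
    by (metis continuous_at_imp_continuous_on has_derivative_continuous)
  then have m_cont: "continuous_on UNIV m"
    by (rule continuous_on_torus)
  obtain \<kappa> where \<kappa>: "0 < \<kappa>"
    "\<And>x u. 0 \<le> u \<Longrightarrow> \<kappa> * ((u - m x)\<^sup>2 / (u + m x)) \<le> entropy_density f m x u"
    using entropy_density_lower_bound[OF f_C2 fu_neg g1_L1_loc f_bound m_pos m_cont f_m] by blast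
  have [measurable]: "m \<in> borel_measurable borel"
    using m_cont by (rule borel_measurable_continuous_onI)
  have "hks_dist_sq (density_measure u0) (density_measure m) \<le> ennreal (36 / \<kappa>) * relative_entropy f m u0"
    if u0: "prob_density u0" for u0
  proof -
    \<comment> \<open>A density may be negative on a null set; \<open>ennreal\<close> already cuts this off in the measure.\<close>
    define u where "u x = max 0 (u0 x)" for x
    have [measurable]: "u0 \<in> borel_measurable borel"
      using u0 borel_measurable_integrable by (fastforce simp: prob_density_def)
    have ae: "AE x in torus_lborel. u x = u0 x"
      using u0 by (auto simp: prob_density_def u_def)
    have "prob_density u"
      unfolding prob_density_def
    proof (intro conjI)
      show "integrable torus_lborel u"
        using u0 by (auto simp: prob_density_def u_def[abs_def])
      show "(\<integral>x. u x \<partial>torus_lborel) = 1"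
        using u0 ae integral_cong_AE[of u torus_lborel u0] by (simp add: prob_density_def u_def[abs_def])
    qed (simp add: u_def)
    moreover have "ennreal (u x) = ennreal (u0 x)" for x
      by (cases "0 \<le> u0 x") (auto simp: u_def max_def ennreal_neg)
    then have "density_measure u = density_measure u0"
      by (simp add: density_measure_def)
    ultimately have "hks_dist_sq (density_measure u0) (density_measure m)
        \<le> (\<integral>\<^sup>+x. ennreal (36 * ((u x - m x)\<^sup>2 / (u x + m x))) \<partial>torus_lborel)"
      using hks_dist_sq_le[of u m] m_density m_pos by (simp add: u_def)
    also have "\<dots> = (\<integral>\<^sup>+x. ennreal (36 / \<kappa>) * ennreal (\<kappa> * ((u x - m x)\<^sup>2 / (u x + m x))) \<partial>torus_lborel)"
      using \<kappa>(1) m_pos by (intro nn_integral_cong) (simp add: ennreal_mult'[symmetric])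
    also have "\<dots> = ennreal (36 / \<kappa>) * (\<integral>\<^sup>+x. ennreal (\<kappa> * ((u x - m x)\<^sup>2 / (u x + m x))) \<partial>torus_lborel)"
      unfolding u_def by (rule nn_integral_cmult) measurable
    also have "\<dots> \<le> ennreal (36 / \<kappa>) * relative_entropy f m u0"
      unfolding relative_entropy_def
    proof (intro mult_left_mono nn_integral_mono_AE)
      show "AE x in torus_lborel. ennreal (\<kappa> * ((u x - m x)\<^sup>2 / (u x + m x)))
          \<le> ennreal (entropy_density f m x (u0 x))"
        using ae
      proof eventually_elim
        case (elim x)
        then have "0 \<le> u0 x" by (simp add: u_def max_def split: if_splits)
        with \<kappa>(2) elim show ?case by (auto intro: ennreal_leI)
      qed
    qed simp
    finally show ?thesis .
  qed
  with \<kappa>(1) show ?thesis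
    by (intro exI[of _ "36 / \<kappa>"]) auto
qed

end
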